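(* Let $\alpha>1$ be a real number, and assume that the class $\mathcal{F}_{3}$ of all finite graphs of maximum degree at most $3$ has a distance-invariant $\alpha$-ADT sketch of size $s(n)$. Then for any $\varepsilon>0$, $s(n)=\Omega\left(n^{\frac{1}{4\alpha}-\varepsilon}\right)$.
   Context: An $\alpha$-ADT sketch of size $s(n)$ for a class $\mathcal{F}$: for every $r\in\mathbb{N}$ there is a function $D_r:\{0,1\}^*\times\{0,1\}^*\to\{0,1\}$ such that for every $G\in\mathcal{F}$ with $n$ vertices there is a probability distribution over functions $\mathsf{sk}:V(G)\to\{0,1\}^{s(n)}$ such that for all $x,y\in V(G)$: $\mathsf{dist}_G(x,y)\le r$ implies $\Pr[D_r(\mathsf{sk}(x),\mathsf{sk}(y))=1]\ge2/3$, and $\mathsf{dist}_G(x,y)>\alpha r$ implies $\Pr[D_r(\mathsf{sk}(x),\mathsf{sk}(y))=0]\ge2/3$. It is distance-invariant if $D_r$ does not depend on $r$. *)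

theory Defs
  imports
    "HOL-Probability.Probability"
    "HOL-Library.Landau_Symbols"
    "Graph_Theory.Graph_Theory"
begin

text \<open>
  A finite simple graph is a \<^locale>\<open>pair_graph\<close>: each undirected edge \<open>uv\<close> is represented by
  the two arcs \<open>(u, v)\<close> and \<open>(v, u)\<close>, so the degree of a vertex is its out-degree. The distance
  is the library's \<open>\<mu>\<close> with unit arc weights; it is \<open>\<infinity>\<close> between different components.
\<close>

definition graph_dist :: "'a pair_pre_digraph \<Rightarrow> 'a \<Rightarrow> 'a \<Rightarrow> ereal" where
  "graph_dist G x y = wf_digraph.\<mu> (with_proj G) (\<lambda>_. 1) x y"

text \<open>
  Every finite graph is isomorphic to one whose vertices are natural numbers, so no generality is
  lost by fixing \<^typ>\<open>nat\<close> as the type of vertices.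
\<close>

definition max_degree_le :: "nat \<Rightarrow> nat pair_pre_digraph set" where
  "max_degree_le d =
     {G. pair_graph G \<and> (\<forall>v \<in> pverts G. out_degree (with_proj G) v \<le> d)}"

text \<open>
  The family of decoders \<open>D\<close> is fixed before the graph, whereas the distribution \<open>P\<close> of the
  sketch may depend both on the radius \<open>r\<close> and on the graph \<open>G\<close>.
\<close>

definition is_adt_sketch ::
  "real \<Rightarrow> (nat \<Rightarrow> nat) \<Rightarrow> 'a pair_pre_digraph set \<Rightarrow>
    (nat \<Rightarrow> bool list \<times> bool list \<Rightarrow> bool) \<Rightarrow> bool" where
  "is_adt_sketch \<alpha> s \<F> D \<longleftrightarrow>
     (\<forall>r. \<forall>G \<in> \<F>. \<exists>P :: ('a \<Rightarrow> bool list) pmf.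
        set_pmf P \<subseteq> pverts G \<rightarrow>\<^sub>E {w. length w = s (card (pverts G))} \<and>
        (\<forall>x \<in> pverts G. \<forall>y \<in> pverts G.
           (graph_dist G x y \<le> ereal (real r) \<longrightarrow>
              measure_pmf.prob P {sk. D r (sk x, sk y)} \<ge> 2 / 3) \<and>
           (graph_dist G x y > ereal (\<alpha> * real r) \<longrightarrow>
              measure_pmf.prob P {sk. \<not> D r (sk x, sk y)} \<ge> 2 / 3)))"

definition has_distance_invariant_adt_sketch ::
  "real \<Rightarrow> (nat \<Rightarrow> nat) \<Rightarrow> 'a pair_pre_digraph set \<Rightarrow> bool" where
  "has_distance_invariant_adt_sketch \<alpha> s \<F> \<longleftrightarrow>
     (\<exists>D. is_adt_sketch \<alpha> s \<F> D \<and> (\<forall>r r'. D r = D r'))"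

end

theory Submission
  imports Defs
begin

text \<open>
  Greedily one finds a graph on \<open>m\<close> vertices with about \<open>m\<^bsup>1+1/a\<^esup>\<close> edges, \<open>a = \<lfloor>\<alpha>\<rfloor>\<close>, in which the
  endpoints of an edge are at distance more than \<open>a\<close> once this edge is removed. Given a set \<open>S\<close> of
  its edges, replace each vertex by a path with \<open>m\<close> slots and each edge in \<open>S\<close> by a path of length
  \<open>L = C m\<close> between the slots reserved for it. The result has maximum degree at most \<open>3\<close>, edges in
  \<open>S\<close> join vertices at distance at most \<open>r = L + 2 m\<close>, and for \<open>C\<close> large the other edges join
  vertices at distance at least \<open>(a + 1) L > \<alpha> r\<close>. By averaging, some outcome of the sketch decodes
  at least two thirds of the edges correctly, so that \<open>S\<close> is determined by the sketches of \<open>m\<close>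
  vertices up to a set of at most a third of the edges. Counting the sets \<open>S\<close> bounds \<open>s n\<close>
  below by a multiple of the average degree, which is of order \<open>n\<^bsup>1/(2a+1)\<^esup>\<close>, and \<open>2 a + 1 < 4 \<alpha>\<close>.
\<close>

section \<open>Distances in pair graphs\<close>

lemma graph_dist_le_relpow:
  assumes "pair_wf_digraph G" "u \<in> pverts G" "(u, v) \<in> parcs G ^^ k"
  shows "graph_dist G u v \<le> ereal (real k)"
proof -
  interpret pair_wf_digraph G by fact
  have "\<exists>p. awalk u p v \<and> length p = k"
    using assms(2,3)
  proof (induction k arbitrary: u)
    case 0
    then show ?case by (auto simp: awalk_Nil_iff)
  next
    case (Suc k)
    then obtain w where w: "(u, w) \<in> parcs G" "(w, v) \<in> parcs G ^^ k"
      by (metis relpow_Suc_D2)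
    then obtain p where "awalk w p v" "length p = k"
      using Suc.IH in_arcsD2 by blast
    with w(1) show ?case
      by (intro exI[of _ "(u, w) # p"]) (auto simp: awalk_Cons_iff)
  qed
  then obtain p where p: "awalk u p v" "length p = k" by blast
  have "graph_dist G u v \<le> awalk_cost (\<lambda>_. 1) p"
    unfolding graph_dist_def using p(1) by (rule min_cost_le_walk_cost)
  also have "awalk_cost (\<lambda>_. 1) p = real k"
    using p(2) by (simp add: awalk_cost_def sum_list_triv)
  finally show ?thesis .
qed

text \<open>Each arc raises \<open>\<phi>\<close> by at most one, so a walk from \<open>u\<close> to
  \<open>v\<close> has length at least \<open>\<phi> v - \<phi> u\<close>. Exhibiting a potential
  thus bounds a distance from below without analysing walks, also when no walk exists.\<close>

lemma graph_dist_ge_potential: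
  fixes \<phi> :: "'a \<Rightarrow> int"
  assumes "pair_wf_digraph G" and lip: "\<And>p q. (p, q) \<in> parcs G \<Longrightarrow> \<phi> q \<le> \<phi> p + 1"
  shows "graph_dist G u v \<ge> ereal (of_int (\<phi> v - \<phi> u))"
proof -
  interpret pair_wf_digraph G by fact
  have "\<phi> v \<le> \<phi> u + int (length p)" if "awalk u p v" for p
    using that
  proof (induction p arbitrary: u)
    case Nil
    then show ?case by (simp add: awalk_Nil_iff)
  next
    case (Cons e p)
    then have "awalk (snd e) p v" "(u, snd e) \<in> parcs G"
      by (auto simp: awalk_Cons_iff)
    then show ?case using Cons.IH[of "snd e"] lip[of u "snd e"] by simp
  qed
  then have "real_of_int (\<phi> v - \<phi> u) \<le> awalk_cost (\<lambda>_. 1) p" if "awalk u p v" for p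
    using that by (fastforce simp: awalk_cost_def sum_list_triv)
  then show ?thesis
    unfolding graph_dist_def \<mu>_def by (intro INF_greatest) auto
qed

text \<open>The size of a sketch depends on the exact number of vertices, so the image of
  \<open>f\<close> is padded with isolated vertices up to \<open>n\<close>. Distances are bounded
  above by relation powers and below by potentials on the original type.\<close>

lemma embedded_graph:
  fixes R :: "('b \<times> 'b) set" and f :: "'b \<Rightarrow> nat"
  assumes fin: "finite W" and R: "R \<subseteq> W \<times> W" "sym R" "irrefl R"
    and deg: "\<And>x. x \<in> W \<Longrightarrow> card (R `` {x}) \<le> d"
    and f: "inj_on f W" "f ` W \<subseteq> {..<n}"
  defines "G \<equiv> \<lparr>pverts = {..<n}, parcs = map_prod f f ` R\<rparr>"
  shows "G \<in> max_degree_le d"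
    and "\<And>x y k. x \<in> W \<Longrightarrow> (x, y) \<in> R ^^ k \<Longrightarrow> graph_dist G (f x) (f y) \<le> ereal (real k)"
    and "\<And>x y (\<phi> :: 'b \<Rightarrow> int). x \<in> W \<Longrightarrow> y \<in> W \<Longrightarrow>
           (\<And>p q. (p, q) \<in> R \<Longrightarrow> \<phi> q \<le> \<phi> p + 1) \<Longrightarrow>
           graph_dist G (f x) (f y) \<ge> ereal (of_int (\<phi> y - \<phi> x))"
proof -
  have finR: "finite R" using R(1) fin by (meson finite_SigmaI finite_subset)
  have RW: "p \<in> W" "q \<in> W" "p \<noteq> q" if "(p, q) \<in> R" for p q
    using that R(1,3) by (auto simp: irrefl_def)
  have wf: "pair_wf_digraph G"
    using R(1) f(2) by unfold_locales (auto simp: G_def, blast+)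
  have "pair_fin_digraph_axioms G"
    using fin finR by unfold_locales (auto simp: G_def)
  moreover have "pair_loopfree_digraph_axioms G"
    using inj_onD[OF f(1)] RW by unfold_locales (fastforce simp: G_def)
  moreover have "pair_sym_digraph_axioms G"
    using R(2) by unfold_locales (force simp: G_def symmetric_def intro!: symI dest: symD)
  ultimately have pg: "pair_graph G"
    by (intro pair_graph.intro pair_digraph.intro pair_fin_digraph.intro pair_loopfree_digraph.intro
      pair_pseudo_graph.intro pair_sym_digraph.intro wf)
  have deg': "out_degree (with_proj G) v \<le> d" for v
  proof (cases "v \<in> f ` W")
    case True
    then obtain x where x: "x \<in> W" "v = f x" by blast
    have "out_arcs (with_proj G) v \<subseteq> (\<lambda>y. (f x, f y)) ` (R `` {x})"
    proof
      fix e assume "e \<in> out_arcs (with_proj G) v"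
      then obtain p q where pq: "(p, q) \<in> R" "e = (f p, f q)" "f p = f x"
        by (auto simp: G_def x(2))
      then have "p = x" using inj_onD[OF f(1)] RW x(1) by blast
      then show "e \<in> (\<lambda>y. (f x, f y)) ` (R `` {x})" using pq by auto
    qed
    then have "card (out_arcs (with_proj G) v) \<le> card (R `` {x})"
      using finR by (meson surj_card_le finite_Image)
    then show ?thesis using deg[OF x(1)] by (simp add: out_degree_def)
  next
    case False
    then have "out_arcs (with_proj G) v = {}"
      using R(1) by (auto simp: out_arcs_def G_def)
    then show ?thesis by (simp add: out_degree_def)
  qed
  show "G \<in> max_degree_le d"
    using pg deg' by (simp add: max_degree_le_def)
  show "graph_dist G (f x) (f y) \<le> ereal (real k)" if "x \<in> W" "(x, y) \<in> R ^^ k" for x y k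
  proof (rule graph_dist_le_relpow[OF wf])
    show "f x \<in> pverts G" using that f(2) by (auto simp: G_def)
    show "(f x, f y) \<in> parcs G ^^ k"
      using that(2)
    proof (induction k arbitrary: y)
      case (Suc k)
      then show ?case by (force simp: G_def)
    qed simp
  qed
  show "graph_dist G (f x) (f y) \<ge> ereal (of_int (\<phi> y - \<phi> x))"
    if "x \<in> W" "y \<in> W" and lip: "\<And>p q. (p, q) \<in> R \<Longrightarrow> \<phi> q \<le> \<phi> p + 1"
    for x y and \<phi> :: "'b \<Rightarrow> int"
  proof -
    \<comment> \<open>The potential is transported along the inverse of \<open>f\<close>. Its
      arbitrary values on the padding do no harm, since every arc lies inside the image.\<close>
    have "ereal (of_int ((\<phi> \<circ> inv_into W f) (f y) - (\<phi> \<circ> inv_into W f) (f x))) \<le> graph_dist G (f x) (f y)"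
    proof (rule graph_dist_ge_potential[OF wf])
      show "(\<phi> \<circ> inv_into W f) q \<le> (\<phi> \<circ> inv_into W f) p + 1" if "(p, q) \<in> parcs G" for p q
        using that R(1) f(1) lip by (auto simp: G_def)
    qed
    then show ?thesis using that f(1) by simp
  qed
qed

section \<open>Dense graphs without short cycles\<close>

text \<open>Powers of the reflexive closure encode walks of length at most \<open>k\<close>: a walk
  may pause at a vertex.\<close>

lemma relpow_reflcl_mono:
  fixes F :: "'a rel"
  assumes "i \<le> j"
  shows "(F\<^sup>=) ^^ i \<subseteq> (F\<^sup>=) ^^ j"
  using assms by (induction rule: dec_induct) auto

text \<open>Volume of a ball of radius \<open>k\<close>: one more step turns each point into at most
  \<open>d + 1\<close> points, itself and its neighbours.\<close>

lemma card_relpow_reflcl_Image: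
  fixes F :: "'a rel"
  assumes "finite F" "\<And>x. card (F `` {x}) \<le> d"
  shows "finite (((F\<^sup>=) ^^ k) `` {x}) \<and> card (((F\<^sup>=) ^^ k) `` {x}) \<le> (d + 1) ^ k"
proof (induction k)
  case (Suc k)
  let ?B = "((F\<^sup>=) ^^ k) `` {x}"
  have eq: "((F\<^sup>=) ^^ Suc k) `` {x} = (\<Union>y\<in>?B. insert y (F `` {y}))" by fastforce
  have fin: "finite (F `` {y})" for y using assms(1) by (simp add: finite_Image)
  have le: "card (insert y (F `` {y})) \<le> d + 1" for y
    using assms(2)[of y] fin[of y] by (simp add: card_insert_if)
  have "card (\<Union>y\<in>?B. insert y (F `` {y})) \<le> (\<Sum>y\<in>?B. card (insert y (F `` {y})))"
    using Suc.IH by (intro card_UN_le) simp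
  also have "\<dots> \<le> card ?B * (d + 1)"
    using sum_bounded_above[of ?B "\<lambda>y. card (insert y (F `` {y}))" "d + 1"] le by simp
  also have "\<dots> \<le> (d + 1) ^ k * (d + 1)" using Suc.IH by (intro mult_le_mono1) simp
  finally show ?case unfolding eq using Suc.IH fin by (simp add: mult.commute)
qed simp

text \<open>A walk that uses the new edge can be trimmed until it uses it only once; the two
  remaining pieces lie in \<open>F\<close>, and the crossing accounts for the strict
  inequality.\<close>

lemma relpow_reflcl_insert_edge:
  fixes F :: "'a rel"
  assumes "(u, v) \<in> ((F \<union> {(x, y), (y, x)})\<^sup>=) ^^ k"
  shows "(u, v) \<in> (F\<^sup>=) ^^ k \<or>
    (\<exists>i j. i + j < k \<and>
      ((u, x) \<in> (F\<^sup>=) ^^ i \<and> (y, v) \<in> (F\<^sup>=) ^^ j \<or> (u, y) \<in> (F\<^sup>=) ^^ i \<and> (x, v) \<in> (F\<^sup>=) ^^ j))"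
  using assms
proof (induction k arbitrary: u)
  case (Suc k)
  obtain w where w: "(u, w) \<in> (F \<union> {(x, y), (y, x)})\<^sup>=" "(w, v) \<in> ((F \<union> {(x, y), (y, x)})\<^sup>=) ^^ k"
    using Suc.prems by (metis relpow_Suc_D2)
  have mono: "(p, v) \<in> (F\<^sup>=) ^^ Suc k" if "(p, v) \<in> (F\<^sup>=) ^^ j" "j \<le> Suc k" for p j
    using relpow_reflcl_mono[OF that(2)] that(1) by blast
  have step: "(p, r) \<in> (F\<^sup>=) ^^ Suc i" if "(p, q) \<in> F\<^sup>=" "(q, r) \<in> (F\<^sup>=) ^^ i" for p q r i
    using that by (rule relpow_Suc_I2)
  have zero: "(p, p) \<in> (F\<^sup>=) ^^ 0" for p by simp
  have xy: ?case if "u = x" "(y, v) \<in> (F\<^sup>=) ^^ j" "j \<le> k" for j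
    using that zero[of x] by (intro disjI2 exI[of _ 0] exI[of _ j]) auto
  have yx: ?case if "u = y" "(x, v) \<in> (F\<^sup>=) ^^ j" "j \<le> k" for j
    using that zero[of y] by (intro disjI2 exI[of _ 0] exI[of _ j]) auto
  consider "(u, w) \<in> F\<^sup>=" | "u = x" "w = y" | "u = y" "w = x" using w(1) by blast
  then show ?case
  proof cases
    case 1
    from Suc.IH[OF w(2)] show ?thesis
    proof (elim disjE exE conjE)
      assume "(w, v) \<in> (F\<^sup>=) ^^ k"
      then show ?thesis using 1 step by blast
    next
      fix i j assume "i + j < k" "(w, x) \<in> (F\<^sup>=) ^^ i" "(y, v) \<in> (F\<^sup>=) ^^ j"
      then show ?thesis using step[OF 1]
        by (intro disjI2 exI[of _ "Suc i"] exI[of _ j]) auto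
    next
      fix i j assume "i + j < k" "(w, y) \<in> (F\<^sup>=) ^^ i" "(x, v) \<in> (F\<^sup>=) ^^ j"
      then show ?thesis using step[OF 1]
        by (intro disjI2 exI[of _ "Suc i"] exI[of _ j]) auto
    qed
  next
    case 2
    from Suc.IH[OF w(2)] show ?thesis
    proof (elim disjE exE conjE)
      assume "(w, v) \<in> (F\<^sup>=) ^^ k"
      then show ?thesis using 2 xy by blast
    next
      fix i j assume "i + j < k" "(y, v) \<in> (F\<^sup>=) ^^ j"
      then show ?thesis using xy[of j] 2 by simp
    next
      \<comment> \<open>The walk crosses from \<open>x\<close> to \<open>y\<close> and later returns
        to \<open>x\<close>; cutting out this excursion leaves a walk in \<open>F\<close>.\<close>
      fix i j assume "i + j < k" "(x, v) \<in> (F\<^sup>=) ^^ j"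
      then show ?thesis using mono[of x j] 2 by simp
    qed
  next
    case 3
    from Suc.IH[OF w(2)] show ?thesis
    proof (elim disjE exE conjE)
      assume "(w, v) \<in> (F\<^sup>=) ^^ k"
      then show ?thesis using 3 yx by blast
    next
      fix i j assume "i + j < k" "(x, v) \<in> (F\<^sup>=) ^^ j"
      then show ?thesis using yx[of j] 3 by simp
    next
      fix i j assume "i + j < k" "(y, v) \<in> (F\<^sup>=) ^^ j"
      then show ?thesis using mono[of y j] 3 by simp
    qed
  qed
qed auto

lemma sym_relpow:
  fixes F :: "'a rel"
  assumes "sym F"
  shows "sym (F ^^ k)"
proof (induction k)
  case (Suc k)
  have "(y, x) \<in> F ^^ Suc k" if "(x, y) \<in> F ^^ Suc k" for x y
  proof -
    from relpow_Suc_D2[OF that] obtain z where "(x, z) \<in> F" "(z, y) \<in> F ^^ k" by blast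
    then have "(y, z) \<in> F ^^ k" and "(z, x) \<in> F" using Suc.IH assms by (auto dest: symD)
    then show ?thesis by (rule relpow_Suc_I)
  qed
  then show ?case by (rule symI)
qed (simp add: sym_Id)

text \<open>For a simple graph this says that every cycle has length at least \<open>a + 2\<close>.
  The form with an edge removed is the one that passes to subgraphs missing that edge.\<close>

definition no_shortcut :: "nat \<Rightarrow> 'a rel \<Rightarrow> bool" where
  "no_shortcut a E \<longleftrightarrow> (\<forall>(u, v)\<in>E. (u, v) \<notin> ((E - {(u, v), (v, u)})\<^sup>=) ^^ a)"

lemma relpow_reflcl_rel_mono: "F \<subseteq> F' \<Longrightarrow> (F\<^sup>=) ^^ k \<subseteq> (F'\<^sup>=) ^^ k" for F F' :: "'a rel"
  by (induction k) auto

text \<open>A shortcut for an old edge \<open>uv\<close> would have to cross the new edge. The rest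
  of it, closed up by \<open>uv\<close>, would join \<open>x\<close> and \<open>y\<close> by a walk
  of length at most \<open>a\<close> in \<open>E\<close>, contrary to \<open>xy\<close>.\<close>

lemma no_shortcut_insert_edge:
  assumes E: "sym E" "no_shortcut a E" and xy: "(x, y) \<notin> (E\<^sup>=) ^^ a"
  shows "no_shortcut a (E \<union> {(x, y), (y, x)})"
  unfolding no_shortcut_def
proof (safe)
  fix u v
  let ?E' = "E \<union> {(x, y), (y, x)}"
  let ?F = "E - {(u, v), (v, u)}"
  have symE: "sym ((E\<^sup>=) ^^ k)" for k using E(1) by (intro sym_relpow sym_Un sym_Id)
  have yx: "(y, x) \<notin> (E\<^sup>=) ^^ a" using xy symE by (metis symD)
  have sub: "(?F\<^sup>=) ^^ k \<subseteq> (E\<^sup>=) ^^ k" for k by (rule relpow_reflcl_rel_mono) auto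
  show False if uv: "(u, v) \<in> E" and walk: "(u, v) \<in> ((?E' - {(u, v), (v, u)})\<^sup>=) ^^ a"
  proof -
    have "(u, v) \<in> ((?F \<union> {(x, y), (y, x)})\<^sup>=) ^^ a"
      using walk relpow_reflcl_rel_mono[where k=a, of "?E' - {(u, v), (v, u)}" "?F \<union> {(x, y), (y, x)}"] by blast
    moreover have "(u, v) \<notin> (?F\<^sup>=) ^^ a" using E(2) uv by (auto simp: no_shortcut_def)
    ultimately obtain i j p q where pq: "i + j < a" "(u, p) \<in> (?F\<^sup>=) ^^ i" "(q, v) \<in> (?F\<^sup>=) ^^ j"
      "(p, q) = (x, y) \<or> (p, q) = (y, x)"
      using relpow_reflcl_insert_edge[of u v a ?F x y] by blast
    \<comment> \<open>Both pieces are read backwards, with the edge \<open>uv\<close> between them;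
      \<open>i + j < a\<close> leaves room for this one extra step.\<close>
    have "(p, u) \<in> (E\<^sup>=) ^^ i" "(v, q) \<in> (E\<^sup>=) ^^ j" "(u, v) \<in> (E\<^sup>=) ^^ 1"
      using pq sub symE uv by (auto dest: symD)
    then have "(p, q) \<in> (E\<^sup>=) ^^ (i + 1 + j)"
      unfolding relpow_add by blast
    then have "(p, q) \<in> (E\<^sup>=) ^^ a"
      using relpow_reflcl_mono[of "i + 1 + j" a E] pq(1) by auto
    then show False using xy yx pq(4) by auto
  qed
  show False if "(x, y) \<in> ((?E' - {(x, y), (y, x)})\<^sup>=) ^^ a"
    using that xy relpow_reflcl_rel_mono[where k=a, of "?E' - {(x, y), (y, x)}" E] by blast
  show False if "(y, x) \<in> ((?E' - {(y, x), (x, y)})\<^sup>=) ^^ a"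
    using that yx relpow_reflcl_rel_mono[where k=a, of "?E' - {(y, x), (x, y)}" E] by blast
qed

text \<open>In a graph with as many edges as possible, any two vertices of degree below
  \<open>d\<close> are within distance \<open>a\<close>, as otherwise they could be joined. They all
  lie in one ball, hence are at most half of the vertices, and the others have degree
  \<open>d\<close>. Here \<open>card E\<close> counts arcs, so each edge twice.\<close>

lemma exists_no_shortcut_graph:
  fixes a d m :: nat
  assumes a: "a \<ge> 1" and m: "2 * (d + 1) ^ a \<le> m"
  obtains E where "E \<subseteq> {..<m} \<times> {..<m}" "sym E" "irrefl E" "no_shortcut a E"
    "card E \<le> m * d" "m * d \<le> 2 * card E"
proof -
  define P where "P E \<longleftrightarrow> E \<subseteq> {..<m} \<times> {..<m} \<and> sym E \<and> irrefl E \<and> no_shortcut a E \<and>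
    (\<forall>x. card (E `` {x}) \<le> d)" for E :: "nat rel"
  have "P {}" by (auto simp: P_def no_shortcut_def irrefl_def sym_def)
  moreover have "card E < Suc (card ({..<m} \<times> {..<m}))" if "P E" for E
    using that card_mono[of "{..<m} \<times> {..<m}" E] by (auto simp: P_def less_Suc_eq_le)
  ultimately obtain E where PE: "P E" and max: "\<And>E'. P E' \<Longrightarrow> card E' \<le> card E"
    using ex_has_greatest_nat[of P "{}" card] by (metis)
  have E: "E \<subseteq> {..<m} \<times> {..<m}" "sym E" "irrefl E" "no_shortcut a E" "\<And>x. card (E `` {x}) \<le> d"
    using PE by (auto simp: P_def)
  have fin: "finite E" using E(1) by (rule finite_subset) simp
  have "E = Sigma {..<m} (\<lambda>x. E `` {x})" using E(1) by auto
  moreover have "card (Sigma {..<m} (\<lambda>x. E `` {x})) = (\<Sum>x<m. card (E `` {x}))"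
    using fin by (intro card_SigmaI) (auto simp: finite_Image)
  ultimately have cardE: "card E = (\<Sum>x<m. card (E `` {x}))" by simp
  define X where "X = {x\<in>{..<m}. card (E `` {x}) < d}"
  have finX: "finite X" by (simp add: X_def)
  have "y \<in> ((E\<^sup>=) ^^ a) `` {x}" if "x \<in> X" "y \<in> X" for x y
  proof (rule ccontr)
    assume "y \<notin> ((E\<^sup>=) ^^ a) `` {x}"
    then have xy: "(x, y) \<notin> (E\<^sup>=) ^^ a" by blast
    then have "x \<noteq> y" using relpow_reflcl_mono[of 0 a E] by auto
    have "(x, y) \<notin> E" using xy a relpow_reflcl_mono[of 1 a E] by auto
    let ?E' = "E \<union> {(x, y), (y, x)}"
    have "P ?E'" unfolding P_def
    proof (intro conjI allI)
      show "?E' \<subseteq> {..<m} \<times> {..<m}" using E(1) that by (auto simp: X_def)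
      show "sym ?E'" using E(2) by (auto simp: sym_def)
      show "irrefl ?E'" using E(3) \<open>x \<noteq> y\<close> by (auto simp: irrefl_def)
      show "no_shortcut a ?E'" using E(2,4) xy by (rule no_shortcut_insert_edge)
      fix z
      have "?E' `` {z} \<subseteq> (if z = x then insert y (E `` {x}) else if z = y then insert x (E `` {y}) else E `` {z})"
        by auto
      then have "card (?E' `` {z}) \<le> card (if z = x then insert y (E `` {x}) else if z = y then insert x (E `` {y}) else E `` {z})"
        using fin by (intro card_mono) (auto simp: finite_Image)
      also have "\<dots> \<le> d"
        using that E(5)[of z] fin by (auto simp: X_def card_insert_if finite_Image)
      finally show "card (?E' `` {z}) \<le> d" .
    qed
    then have "card ?E' \<le> card E" by (rule max)
    moreover have "E \<subset> ?E'" using \<open>(x, y) \<notin> E\<close> by auto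
    ultimately show False using fin psubset_card_mono[of ?E' E] by auto
  qed
  then have "card X \<le> (d + 1) ^ a"
  proof (cases "X = {}")
    case False
    then obtain x where "x \<in> X" by blast
    then have "X \<subseteq> ((E\<^sup>=) ^^ a) `` {x}" using \<open>\<And>x y. x \<in> X \<Longrightarrow> y \<in> X \<Longrightarrow> _\<close> by blast
    then show ?thesis
      using card_relpow_reflcl_Image[OF fin E(5), of a x] card_mono order_trans by blast
  qed simp
  then have "2 * card X \<le> m" using m by linarith
  moreover have "card ({..<m} - X) = m - card X"
    using finX by (subst card_Diff_subset) (auto simp: X_def)
  ultimately have "m \<le> 2 * card ({..<m} - X)" by linarith
  then have "m * d \<le> 2 * (card ({..<m} - X) * d)"
    using mult_le_mono1[of m "2 * card ({..<m} - X)" d] by (simp add: mult.assoc)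
  also have "card ({..<m} - X) * d \<le> (\<Sum>x\<in>{..<m} - X. card (E `` {x}))"
  proof -
    have "d \<le> card (E `` {x})" if "x \<in> {..<m} - X" for x using that by (auto simp: X_def not_less)
    then show ?thesis
      using sum_bounded_below[of "{..<m} - X" d "\<lambda>x. card (E `` {x})"] by simp
  qed
  also have "\<dots> \<le> card E" unfolding cardE by (intro sum_mono2) auto
  finally have "m * d \<le> 2 * card E" by simp
  moreover have "card E \<le> m * d"
    unfolding cardE using sum_bounded_above[of "{..<m}" "\<lambda>x. card (E `` {x})" d] E(5) by simp
  ultimately show ?thesis using E that by blast
qed

section \<open>Subdivided graphs of maximum degree 3\<close>

text \<open>Slot \<open>w\<close> in the row of \<open>u\<close> is \<open>(u, w, 0)\<close>. An
  edge \<open>uv\<close> becomes a path of length \<open>L\<close> from slot \<open>v\<close> of row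
  \<open>u\<close> through \<open>(u, v, 1)\<close>, ..., \<open>(u, v, L - 1)\<close> to slot
  \<open>u\<close> of row \<open>v\<close>; its starting point is itself the slot.\<close>

definition half_arcs :: "nat \<Rightarrow> nat \<Rightarrow> nat rel \<Rightarrow> (nat \<times> nat \<times> nat) rel" where
  "half_arcs m L S =
     {((u, w, 0), (u, Suc w, 0)) | u w. u < m \<and> Suc w < m} \<union>
     {((u, v, i), (u, v, Suc i)) | u v i. (u, v) \<in> S \<and> Suc i < L} \<union>
     {((u, v, L - 1), (v, u, 0)) | u v. (u, v) \<in> S}"

definition gadget_arcs :: "nat \<Rightarrow> nat \<Rightarrow> nat rel \<Rightarrow> (nat \<times> nat \<times> nat) rel" where
  "gadget_arcs m L S = half_arcs m L S \<union> (half_arcs m L S)\<inverse>"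

text \<open>The points are laid out for all of \<open>A\<close>, so that a single vertex set
  accommodates the gadgets of every \<open>S\<close> contained in \<open>A\<close>.\<close>

definition gadget_verts :: "nat \<Rightarrow> nat \<Rightarrow> nat rel \<Rightarrow> (nat \<times> nat \<times> nat) set" where
  "gadget_verts m L A =
     (\<lambda>(u, w). (u, w, 0)) ` ({..<m} \<times> {..<m}) \<union> (\<lambda>((u, v), i). (u, v, i)) ` (A \<times> {..<L})"

lemma gadget_verts_iff:
  "(u, v, i) \<in> gadget_verts m L A \<longleftrightarrow> i = 0 \<and> u < m \<and> v < m \<or> (u, v) \<in> A \<and> i < L"
  by (force simp: gadget_verts_def)

lemma finite_gadget_verts: "finite A \<Longrightarrow> finite (gadget_verts m L A)"
  by (simp add: gadget_verts_def)

lemma card_gadget_verts: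
  assumes "finite A"
  shows "card (gadget_verts m L A) \<le> m * m + card A * L"
proof -
  have "card ((\<lambda>(u, w). (u, w, 0 :: nat)) ` ({..<m} \<times> {..<m})) \<le> m * m"
    by (rule card_image_le[THEN order_trans]) auto
  moreover have "card ((\<lambda>((u, v), i). (u, v, i)) ` (A \<times> {..<L})) \<le> card A * L"
    using assms by (intro card_image_le[THEN order_trans]) auto
  ultimately show ?thesis
    unfolding gadget_verts_def by (intro card_Un_le[THEN order_trans] add_mono)
qed

lemma sym_gadget_arcs: "sym (gadget_arcs m L S)"
  by (auto simp: gadget_arcs_def sym_def)

lemma gadget_arcs_subset:
  assumes "S \<subseteq> A" "A \<subseteq> {..<m} \<times> {..<m}" "0 < L"
  shows "gadget_arcs m L S \<subseteq> gadget_verts m L A \<times> gadget_verts m L A"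
proof -
  have "half_arcs m L S \<subseteq> gadget_verts m L A \<times> gadget_verts m L A"
    using assms by (auto simp: half_arcs_def gadget_verts_iff)
  then show ?thesis by (auto simp: gadget_arcs_def)
qed

lemma irrefl_gadget_arcs:
  assumes "\<And>u v. (u, v) \<in> S \<Longrightarrow> u < v"
  shows "irrefl (gadget_arcs m L S)"
  using assms by (fastforce simp: gadget_arcs_def half_arcs_def irrefl_def)

text \<open>A slot has at most two neighbours in its row and lies on at most one edge path, since
  slot \<open>b\<close> of row \<open>a\<close> is reserved for the edge \<open>ab\<close> and
  \<open>S\<close> contains only one orientation of it. Inner points of paths have two
  neighbours.\<close>

lemma gadget_degree:
  assumes S: "\<And>u v. (u, v) \<in> S \<Longrightarrow> u < v" and L: "2 \<le> L"
  shows "card (gadget_arcs m L S `` {x}) \<le> 3"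
proof -
  obtain a b i where x: "x = (a, b, i)" by (cases x) auto
  define N where "N = (if i = 0
    then {(a, Suc b, 0), (a, b - 1, 0), if a < b then (a, b, 1) else (b, a, L - 1)}
    else {(a, b, i - 1), if Suc i < L then (a, b, Suc i) else (b, a, 0)})"
  have "gadget_arcs m L S `` {x} \<subseteq> N"
    unfolding x N_def gadget_arcs_def half_arcs_def using L
    by (auto dest: S)
  moreover have "card N \<le> 3" "finite N"
    by (auto simp: N_def card_insert_if)
  ultimately show ?thesis by (meson card_mono le_trans)
qed

text \<open>The three summands are the way to slot \<open>v\<close> in row \<open>u\<close>, the
  edge path, and the way back from slot \<open>u\<close> in row \<open>v\<close>.\<close>

lemma gadget_path:
  assumes "u < m" "v < m" "(u, v) \<in> S" "0 < L"
  shows "((u, 0, 0), (v, 0, 0)) \<in> gadget_arcs m L S ^^ (v + L + u)"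
proof -
  let ?R = "gadget_arcs m L S"
  have slots: "((p, 0, 0), (p, w, 0)) \<in> ?R ^^ w" if "p < m" "w < m" for p w
    using that(2)
  proof (induction w)
    case (Suc w)
    moreover have "((p, w, 0), (p, Suc w, 0)) \<in> ?R"
      using that(1) Suc.prems by (auto simp: gadget_arcs_def half_arcs_def)
    ultimately show ?case by (auto intro: relpow_Suc_I)
  qed simp
  have edge: "((u, v, 0), (u, v, i)) \<in> ?R ^^ i" if "i < L" for i
    using that
  proof (induction i)
    case (Suc i)
    moreover have "((u, v, i), (u, v, Suc i)) \<in> ?R"
      using assms(3) Suc.prems by (auto simp: gadget_arcs_def half_arcs_def)
    ultimately show ?case by (auto intro: relpow_Suc_I)
  qed simp
  have "((u, v, L - 1), (v, u, 0)) \<in> ?R"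
    using assms(3) by (auto simp: gadget_arcs_def half_arcs_def)
  with edge[of "L - 1"] have "((u, v, 0), (v, u, 0)) \<in> ?R ^^ Suc (L - 1)"
    using assms(4) by (intro relpow_Suc_I) auto
  then have L: "((u, v, 0), (v, u, 0)) \<in> ?R ^^ L" using assms(4) by simp
  have "((v, u, 0), (v, 0, 0)) \<in> ?R ^^ u"
    using slots[of v u] assms sym_relpow[OF sym_gadget_arcs] by (metis symD)
  with L slots[of u v] assms show ?thesis unfolding relpow_add by blast
qed

text \<open>Rows are mapped to multiples of \<open>L\<close>, and a path replacing an edge interpolates linearly.\<close>

definition gadget_potential :: "nat \<Rightarrow> (nat \<Rightarrow> int) \<Rightarrow> nat \<times> nat \<times> nat \<Rightarrow> int" where
  "gadget_potential L k = (\<lambda>(a, b, i). int L * k a + (k b - k a) * int i)"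

text \<open>The potential is constant on rows, and each of the \<open>L\<close> steps along an edge
  path changes it by \<open>k v - k u\<close>, including the last one, which enters the row of
  \<open>v\<close>.\<close>

lemma gadget_potential_lipschitz:
  assumes k: "\<And>u v. (u, v) \<in> S \<Longrightarrow> \<bar>k u - k v\<bar> \<le> 1" and "0 < L"
    and pq: "(p, q) \<in> gadget_arcs m L S"
  shows "gadget_potential L k q \<le> gadget_potential L k p + 1"
proof -
  have "\<bar>gadget_potential L k p - gadget_potential L k q\<bar> \<le> 1" if "(p, q) \<in> half_arcs m L S" for p q
    using that unfolding half_arcs_def
  proof (elim UnE CollectE exE conjE)
    fix u v assume "(p, q) = ((u, v, L - 1), (v, u, 0))" "(u, v) \<in> S"
    then show ?thesis
      using k[of u v] \<open>0 < L\<close> by (simp add: gadget_potential_def of_nat_diff algebra_simps)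
  next
    fix u v i assume "(p, q) = ((u, v, i), (u, v, Suc i))" "(u, v) \<in> S"
    then show ?thesis using k[of u v] by (simp add: gadget_potential_def algebra_simps)
  qed (simp add: gadget_potential_def)
  from this[of p q] this[of q p] show ?thesis using pq by (auto simp: gadget_arcs_def)
qed

text \<open>The function is the distance from \<open>x\<close> cut off at \<open>a + 1\<close>,
  obtained by counting the radii \<open>j \<le> a\<close> whose ball around \<open>x\<close> misses
  \<open>v\<close>. Counting also covers vertices not reachable from \<open>x\<close>.\<close>

lemma exists_truncated_distance:
  fixes R :: "'a rel"
  assumes "sym R" "(x, y) \<notin> (R\<^sup>=) ^^ a"
  obtains k :: "'a \<Rightarrow> int" where "k x = 0" "k y = int a + 1" "\<And>u v. (u, v) \<in> R \<Longrightarrow> \<bar>k u - k v\<bar> \<le> 1"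
proof -
  define N where "N v = {j\<in>{..a}. (x, v) \<notin> (R\<^sup>=) ^^ j}" for v
  have fin: "finite (N v)" for v by (simp add: N_def)
  have step: "card (N w) \<le> card (N v) + 1" if "(v, w) \<in> R" for v w
  proof -
    \<comment> \<open>If radius \<open>i + 1\<close> misses \<open>w\<close>, then radius
      \<open>i\<close> misses its neighbour \<open>v\<close>; only radius \<open>0\<close> has no
      predecessor.\<close>
    have "N w \<subseteq> insert 0 (Suc ` N v)"
    proof
      fix j assume j: "j \<in> N w"
      show "j \<in> insert 0 (Suc ` N v)"
      proof (cases j)
        case (Suc i)
        have "(x, v) \<notin> (R\<^sup>=) ^^ i" using j that by (auto simp: N_def Suc)
        then show ?thesis using j by (auto simp: N_def Suc)
      qed simp
    qed
    then have "card (N w) \<le> card (insert 0 (Suc ` N v))" using fin by (intro card_mono) auto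
    also have "\<dots> \<le> Suc (card (Suc ` N v))" using fin by (simp add: card_insert_if)
    also have "\<dots> = card (N v) + 1" by (simp add: card_image)
    finally show ?thesis .
  qed
  have "(x, x) \<in> (R\<^sup>=) ^^ j" for j using relpow_reflcl_mono[of 0 j R] by auto
  then have "card (N x) = 0" by (simp add: N_def)
  moreover have "N y = {..a}"
    using assms(2) relpow_reflcl_mono[of _ a R] by (auto simp: N_def)
  then have "card (N y) = a + 1" by simp
  moreover have "\<bar>int (card (N u)) - int (card (N v))\<bar> \<le> 1" if "(u, v) \<in> R" for u v
    using step[OF that] step[of v u] that assms(1) by (auto dest: symD)
  ultimately show thesis using that[of "\<lambda>v. int (card (N v))"] by simp
qed

section \<open>Counting sketches\<close>

lemma power_swap: "(x ^ m) ^ n = (x ^ n) ^ m" for x :: "'a :: monoid_mult"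
  by (metis mult.commute power_mult)

lemma sum_Pow_power:
  fixes z :: real
  assumes "finite A"
  shows "(\<Sum>X\<in>Pow A. z ^ card X) = (1 + z) ^ card A"
  using assms
proof (induction A rule: finite_induct)
  case (insert x A)
  have "(\<Sum>X\<in>Pow (insert x A). z ^ card X) = (\<Sum>X\<in>Pow A. z ^ card X) + (\<Sum>X\<in>insert x ` Pow A. z ^ card X)"
    unfolding Pow_insert using insert.hyps by (intro sum.union_disjoint) auto
  also have "(\<Sum>X\<in>insert x ` Pow A. z ^ card X) = (\<Sum>X\<in>Pow A. z ^ card (insert x X))"
    using insert.hyps by (subst sum.reindex) (auto simp: inj_on_def)
  also have "\<dots> = (\<Sum>X\<in>Pow A. z * z ^ card X)"
  proof (intro sum.cong refl)
    fix X assume "X \<in> Pow A"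
    then have "finite X" "x \<notin> X" using insert.hyps finite_subset by auto
    then show "z ^ card (insert x X) = z * z ^ card X" by simp
  qed
  finally show ?case using insert by (simp add: sum_distrib_left[symmetric] algebra_simps)
qed simp

text \<open>A Chernoff bound with parameter \<open>1/2\<close>; the cube clears the exponent \<open>card A / 3\<close>.\<close>

lemma card_small_subsets_cube:
  assumes "finite A"
  shows "real (card {X\<in>Pow A. 3 * card X \<le> card A}) ^ 3 \<le> (27/4) ^ card A"
proof -
  let ?B = "{X\<in>Pow A. 3 * card X \<le> card A}" and ?e = "card A"
  \<comment> \<open>The least weight of a small subset. A real exponent is taken because
    \<open>card A\<close> need not be divisible by 3.\<close>
  define q where "q = (1/2 :: real) powr (?e / 3)"
  have "q > 0" by (simp add: q_def)
  have "q \<le> (1/2) ^ card X" if "X \<in> ?B" for X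
  proof -
    have "q \<le> (1/2) powr real (card X)"
      unfolding q_def using that by (intro powr_mono') auto
    then show ?thesis by (simp add: powr_realpow)
  qed
  then have "real (card ?B) * q \<le> (\<Sum>X\<in>?B. (1/2) ^ card X)"
    by (metis (no_types, lifting) sum_bounded_below)
  also have "\<dots> \<le> (\<Sum>X\<in>Pow A. (1/2) ^ card X)"
    using assms by (intro sum_mono2) auto
  also have "\<dots> = (3/2) ^ ?e" using sum_Pow_power[OF assms, of "1/2"] by simp
  finally have "(real (card ?B) * q) ^ 3 \<le> ((3/2) ^ ?e) ^ 3"
    using \<open>q > 0\<close> by (intro power_mono) auto
  moreover have "q ^ 3 = (1/2) ^ ?e"
  proof -
    have "q ^ 3 = q powr 3" using \<open>q > 0\<close> by simp
    also have "\<dots> = (1/2) powr real ?e" unfolding q_def by (simp add: powr_powr)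
    finally show ?thesis by (simp add: powr_realpow)
  qed
  moreover have "((3/2 :: real) ^ ?e) ^ 3 = ((3/2) ^ 3) ^ ?e" by (rule power_swap)
  ultimately have "real (card ?B) ^ 3 * (1/2) ^ ?e \<le> (27/8) ^ ?e"
    by (simp add: power_mult_distrib power_divide)
  then have "real (card ?B) ^ 3 * (1/2) ^ ?e * 2 ^ ?e \<le> (27/8) ^ ?e * 2 ^ ?e"
    by (intro mult_right_mono) auto
  also have "\<dots> = (27/4) ^ ?e" by (simp flip: power_mult_distrib)
  finally show ?thesis by (simp add: mult.assoc flip: power_mult_distrib)
qed

text \<open>The expected number of failures is at most \<open>card A / 3\<close>, and some outcome
  in the support does not exceed the expectation.\<close>

lemma exists_mostly_correct_outcome:
  fixes P :: "'a pmf"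
  assumes A: "finite A" and prob: "\<And>x. x \<in> A \<Longrightarrow> measure_pmf.prob P {\<omega>. C x \<omega>} \<ge> 2 / 3"
  shows "\<exists>\<omega>\<in>set_pmf P. 3 * card {x\<in>A. \<not> C x \<omega>} \<le> card A"
proof (rule ccontr)
  assume neg: "\<not> ?thesis"
  let ?e = "\<lambda>\<omega>. \<Sum>x\<in>A. indicator {\<omega>. \<not> C x \<omega>} \<omega> :: real"
  have e: "?e \<omega> = real (card {x\<in>A. \<not> C x \<omega>})" for \<omega>
    using A by (simp add: indicator_def sum.If_cases Int_def)
  have int: "integrable P ?e"
    by (intro Bochner_Integration.integrable_sum integrable_real_indicator)
      (auto simp: measure_pmf.emeasure_finite less_top[symmetric])
  have compl: "measure_pmf.prob P {\<omega>. \<not> C x \<omega>} \<le> 1 / 3" if "x \<in> A" for x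
    using prob[OF that] measure_pmf.prob_compl[of "{\<omega>. C x \<omega>}" P] by (simp add: Compl_eq set_diff_eq)
  \<comment> \<open>Failures are counted by integers, so if every outcome were bad the expectation
    would exceed \<open>card A / 3\<close> by a definite amount.\<close>
  have "(card A + 1) / 3 \<le> measure_pmf.expectation P ?e"
  proof -
    have "measure_pmf.expectation P (\<lambda>_. (card A + 1) / 3 :: real) \<le> measure_pmf.expectation P ?e"
    proof (intro integral_mono_AE int AE_pmfI)
      fix \<omega> assume "\<omega> \<in> set_pmf P"
      then have "card A + 1 \<le> 3 * card {x\<in>A. \<not> C x \<omega>}" using neg by auto
      then have "real (card A + 1) \<le> real (3 * card {x\<in>A. \<not> C x \<omega>})" by (rule of_nat_mono)
      then show "(card A + 1) / 3 \<le> ?e \<omega>" unfolding e by simp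
    qed auto
    then show ?thesis by simp
  qed
  also have "\<dots> = (\<Sum>x\<in>A. measure_pmf.prob P {\<omega>. \<not> C x \<omega>})"
    by (subst Bochner_Integration.integral_sum) (auto simp: measure_pmf.emeasure_finite less_top[symmetric])
  also have "\<dots> \<le> real (card A) * (1 / 3)"
    using sum_bounded_above[of A "\<lambda>x. measure_pmf.prob P {\<omega>. \<not> C x \<omega>}" "1/3"] compl by simp
  finally show False by simp
qed

text \<open>A set \<open>S\<close> is recovered from one sketch on \<open>V\<close>, which decodes
  to \<open>T sk\<close>, together with the small set of errors. Comparing the number of such pairs
  with \<open>2 ^ card A\<close> and cubing leaves the base \<open>8 / (27/4) = 32/27\<close>, which
  exceeds 1.\<close>

lemma sketch_counting:
  fixes A :: "('v \<times> 'v) set" and D :: "'l \<times> 'l \<Rightarrow> bool"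
  assumes fin: "finite A" "finite V" "finite \<Lambda>" and AV: "A \<subseteq> V \<times> V"
    and sketch: "\<And>S. S \<subseteq> A \<Longrightarrow> \<exists>P :: ('v \<Rightarrow> 'l) pmf. set_pmf P \<subseteq> {sk. \<forall>v\<in>V. sk v \<in> \<Lambda>} \<and>
      (\<forall>(u, v)\<in>A. measure_pmf.prob P {sk. D (sk u, sk v) \<longleftrightarrow> (u, v) \<in> S} \<ge> 2 / 3)"
  shows "(32/27 :: real) ^ card A \<le> (card \<Lambda> ^ card V) ^ 3"
proof -
  let ?F = "V \<rightarrow>\<^sub>E \<Lambda>"
  define T where "T sk = {(u, v)\<in>A. D (sk u, sk v)}" for sk :: "'v \<Rightarrow> 'l"
  let ?B = "{X\<in>Pow A. 3 * card X \<le> card A}"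
  have sub: "Pow A \<subseteq> (\<lambda>(sk, X). sym_diff (T sk) X) ` (?F \<times> ?B)"
  proof
    fix S assume "S \<in> Pow A"
    then have S: "S \<subseteq> A" by simp
    from sketch[OF S] obtain P :: "('v \<Rightarrow> 'l) pmf" where P: "set_pmf P \<subseteq> {sk. \<forall>v\<in>V. sk v \<in> \<Lambda>}"
      "\<And>x. x \<in> A \<Longrightarrow> measure_pmf.prob P {sk. D (sk (fst x), sk (snd x)) \<longleftrightarrow> x \<in> S} \<ge> 2 / 3" by fastforce
    from exists_mostly_correct_outcome[of A P "\<lambda>x sk. D (sk (fst x), sk (snd x)) \<longleftrightarrow> x \<in> S", OF fin(1) P(2)]
    obtain sk where sk: "sk \<in> set_pmf P"
      "3 * card {x\<in>A. \<not> (D (sk (fst x), sk (snd x)) \<longleftrightarrow> x \<in> S)} \<le> card A" by blast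
    have T: "T (restrict sk V) = {x\<in>A. D (sk (fst x), sk (snd x))}" using AV by (auto simp: T_def)
    have "restrict sk V \<in> ?F" using sk(1) P(1) by auto
    moreover have "sym_diff (T (restrict sk V)) S = {x\<in>A. \<not> (D (sk (fst x), sk (snd x)) \<longleftrightarrow> x \<in> S)}"
      using S by (auto simp: T)
    then have "sym_diff (T (restrict sk V)) S \<in> ?B" using sk(2) by auto
    moreover have "S = sym_diff (T (restrict sk V)) (sym_diff (T (restrict sk V)) S)" by auto
    ultimately show "S \<in> (\<lambda>(sk, X). sym_diff (T sk) X) ` (?F \<times> ?B)"
      by (intro image_eqI[of _ _ "(restrict sk V, sym_diff (T (restrict sk V)) S)"]) auto
  qed
  have finF: "finite ?F" using fin by (intro finite_PiE) auto
  have "2 ^ card A = card (Pow A)" using fin(1) by (simp add: card_Pow)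
  also have "\<dots> \<le> card (?F \<times> ?B)"
    using finF fin(1) by (intro surj_card_le[OF _ sub]) auto
  also have "\<dots> = card \<Lambda> ^ card V * card ?B"
    using fin(2) by (simp add: card_cartesian_product card_PiE)
  finally have "real (2 ^ card A) \<le> real (card \<Lambda> ^ card V * card ?B)" by (rule of_nat_mono)
  then have "(2 ^ card A :: real) ^ 3 \<le> (real (card \<Lambda>) ^ card V * real (card ?B)) ^ 3"
    by (intro power_mono) auto
  also have "\<dots> \<le> (card \<Lambda> ^ card V) ^ 3 * (27/4) ^ card A"
    using card_small_subsets_cube[OF fin(1)]
    by (simp only: power_mult_distrib of_nat_power) (intro mult_left_mono, auto)
  finally have *: "(8 :: real) ^ card A \<le> (card \<Lambda> ^ card V) ^ 3 * (27/4) ^ card A"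
    using power_swap[of "2 :: real" "card A" 3] by simp
  have "(32/27 :: real) ^ card A = 8 ^ card A / (27/4) ^ card A"
    by (simp add: power_divide[symmetric])
  also have "\<dots> \<le> (card \<Lambda> ^ card V) ^ 3" using * by (simp add: pos_divide_le_eq)
  finally show ?thesis .
qed

section \<open>The lower bound\<close>

text \<open>Here \<open>d\<close> is the degree of the dense graph, which has of order
  \<open>d ^ a\<close> vertices. Its gadget fits into \<open>n\<close> vertices, and the number
  \<open>m\<close> of sketches cancels against the \<open>m\<close> in the number of edges.\<close>

lemma sketch_size_lower_bound:
  fixes \<alpha> :: real and a C d n :: nat
  assumes sk: "is_adt_sketch \<alpha> s (max_degree_le 3) D"
    and pos: "1 \<le> a" "1 \<le> C" "1 \<le> d"
    and C: "2 * \<alpha> < (real a + 1 - \<alpha>) * C"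
    and n: "C * 2 ^ (2 * a + 3) * d ^ (2 * a + 1) \<le> n"
  shows "real d * ln (32 / 27) \<le> 12 * ln 2 * real (s n)"
proof -
  define m where "m = 2 * (d + 1) ^ a"
  define L where "L = C * m"
  define r where "r = L + 2 * m"
  have m: "2 \<le> m" unfolding m_def using one_le_power[of "d + 1" a] by linarith
  have L: "2 \<le> L" using mult_le_mono[OF pos(2) m] by (simp add: L_def)
  \<comment> \<open>The hypothesis on \<open>C\<close> says
    \<open>\<alpha> * (C + 2) < (a + 1) * C\<close>; multiplying by \<open>m\<close> separates the
    two distance scales.\<close>
  have gap: "\<alpha> * real r < real L * (real a + 1)"
    using mult_strict_right_mono[OF C, of "real m"] m by (simp add: r_def L_def algebra_simps)
  obtain E where E: "E \<subseteq> {..<m} \<times> {..<m}" "sym E" "irrefl E" "no_shortcut a E"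
    "card E \<le> m * d" "m * d \<le> 2 * card E"
    using exists_no_shortcut_graph[of a d m] pos(1) by (auto simp: m_def)
  define A where "A = {(u, v)\<in>E. u < v}"
  have AE: "A \<subseteq> E" and Alt: "\<And>u v. (u, v) \<in> A \<Longrightarrow> u < v" by (auto simp: A_def)
  have Am: "A \<subseteq> {..<m} \<times> {..<m}" using AE E(1) by blast
  have finE: "finite E" using E(1) by (rule finite_subset) simp
  then have finA: "finite A" using AE finite_subset by blast
  have cardA: "card A \<le> m * d" using card_mono[OF finE AE] E(5) by simp
  have "E \<subseteq> A \<union> A\<inverse>"
  proof (rule subrelI)
    fix u v assume "(u, v) \<in> E"
    moreover from this have "(v, u) \<in> E" "u \<noteq> v" using E(2,3) by (auto simp: irrefl_def dest: symD)
    ultimately show "(u, v) \<in> A \<union> A\<inverse>" by (auto simp: A_def)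
  qed
  then have "card E \<le> card (A \<union> A\<inverse>)" using finA by (intro card_mono) auto
  also have "\<dots> \<le> card A + card A" using card_Un_le[of A "A\<inverse>"] by simp
  finally have md: "m * d \<le> 4 * card A" using E(6) by simp

  let ?W = "gadget_verts m L A"
  have "card ?W \<le> n"
  proof -
    have "card ?W \<le> m * m + card A * L" by (rule card_gadget_verts[OF finA])
    also have "\<dots> \<le> m * m * (C * d) + m * d * L"
      using cardA pos by (intro add_mono mult_le_mono1) auto
    also have "\<dots> = 2 * C * d * m ^ 2" by (simp add: L_def power2_eq_square)
    also have "\<dots> \<le> 2 * C * d * (2 * (2 * d) ^ a) ^ 2"
      unfolding m_def using pos by (intro mult_le_mono2 power_mono) auto
    also have "\<dots> = C * 2 ^ (2 * a + 3) * d ^ (2 * a + 1)"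
      by (simp add: power_mult_distrib power_add power_mult power_swap[of _ a 2])
    finally show ?thesis using n by simp
  qed
  then obtain f where f: "f ` ?W \<subseteq> {..<n}" "inj_on f ?W"
    using card_le_inj[of ?W "{..<n}"] finite_gadget_verts[OF finA] by auto
  have slot: "(u, 0, 0) \<in> ?W" if "u < m" for u using that m by (simp add: gadget_verts_iff)

  let ?\<Lambda> = "{w :: bool list. length w = s n}"
  have "(32/27 :: real) ^ card A \<le> (card ?\<Lambda> ^ card {..<m}) ^ 3"
  proof (rule sketch_counting[where D = "D r"])
    show "finite ?\<Lambda>" using finite_lists_length_eq[of "UNIV :: bool set" "s n"] by simp
    fix S assume S: "S \<subseteq> A"
    then have Slt: "\<And>u v. (u, v) \<in> S \<Longrightarrow> u < v" using Alt by blast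
    define R where "R = gadget_arcs m L S"
    define G where "G = \<lparr>pverts = {..<n}, parcs = map_prod f f ` R\<rparr>"
    have "R \<subseteq> ?W \<times> ?W" unfolding R_def using L by (intro gadget_arcs_subset[OF S Am]) simp
    moreover have "sym R" unfolding R_def by (rule sym_gadget_arcs)
    moreover have "irrefl R" unfolding R_def by (rule irrefl_gadget_arcs[OF Slt])
    moreover have "card (R `` {x}) \<le> 3" for x unfolding R_def by (rule gadget_degree[OF Slt L])
    ultimately have G: "G \<in> max_degree_le 3"
      "\<And>x y k. x \<in> ?W \<Longrightarrow> (x, y) \<in> R ^^ k \<Longrightarrow> graph_dist G (f x) (f y) \<le> ereal (real k)"
      "\<And>x y (\<phi> :: _ \<Rightarrow> int). x \<in> ?W \<Longrightarrow> y \<in> ?W \<Longrightarrow> (\<And>p q. (p, q) \<in> R \<Longrightarrow> \<phi> q \<le> \<phi> p + 1) \<Longrightarrow>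
         graph_dist G (f x) (f y) \<ge> ereal (of_int (\<phi> y - \<phi> x))"
      unfolding G_def using embedded_graph[OF finite_gadget_verts[OF finA] _ _ _ _ f(2,1), of R 3] by blast+
    \<comment> \<open>Slot 0 of its row represents the vertex \<open>u\<close>; only the sketches of
      these \<open>m\<close> vertices are used.\<close>
    define g where "g u = f (u, 0, 0)" for u
    have g: "g u \<in> pverts G" if "u < m" for u using slot[OF that] f(1) by (auto simp: g_def G_def)
    have "card (pverts G) = n" by (simp add: G_def)
    then obtain P :: "(nat \<Rightarrow> bool list) pmf" where
      P: "set_pmf P \<subseteq> pverts G \<rightarrow>\<^sub>E ?\<Lambda>" and
      near: "\<And>x y. x \<in> pverts G \<Longrightarrow> y \<in> pverts G \<Longrightarrow> graph_dist G x y \<le> ereal (real r) \<Longrightarrow>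
        measure_pmf.prob P {sk. D r (sk x, sk y)} \<ge> 2 / 3" and
      far: "\<And>x y. x \<in> pverts G \<Longrightarrow> y \<in> pverts G \<Longrightarrow> graph_dist G x y > ereal (\<alpha> * real r) \<Longrightarrow>
        measure_pmf.prob P {sk. \<not> D r (sk x, sk y)} \<ge> 2 / 3"
    proof -
      have "\<exists>P :: (nat \<Rightarrow> bool list) pmf. set_pmf P \<subseteq> pverts G \<rightarrow>\<^sub>E {w. length w = s (card (pverts G))} \<and>
        (\<forall>x \<in> pverts G. \<forall>y \<in> pverts G.
           (graph_dist G x y \<le> ereal (real r) \<longrightarrow> measure_pmf.prob P {sk. D r (sk x, sk y)} \<ge> 2 / 3) \<and>
           (graph_dist G x y > ereal (\<alpha> * real r) \<longrightarrow> measure_pmf.prob P {sk. \<not> D r (sk x, sk y)} \<ge> 2 / 3))"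
        using sk G(1) unfolding is_adt_sketch_def by (elim allE[of _ r] bspec)
      then show ?thesis using that unfolding \<open>card (pverts G) = n\<close> by blast
    qed
    have "measure_pmf.prob (map_pmf (\<lambda>sk u. sk (g u)) P) {sk. D r (sk u, sk v) \<longleftrightarrow> (u, v) \<in> S} \<ge> 2 / 3"
      if uv: "(u, v) \<in> A" for u v
    proof (cases "(u, v) \<in> S")
      case True
      have "u < m" "v < m" using uv Am by auto
      then have "graph_dist G (g u) (g v) \<le> ereal (real (v + L + u))"
        unfolding g_def using L True slot
        by (intro G(2)) (auto simp: R_def intro!: gadget_path)
      also have "\<dots> \<le> ereal (real r)" using \<open>u < m\<close> \<open>v < m\<close> by (simp add: r_def)
      finally show ?thesis using near[of "g u" "g v"] g \<open>u < m\<close> \<open>v < m\<close> True by simp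
    next
      case False
      have "u < m" "v < m" using uv Am by auto
      \<comment> \<open>As \<open>S\<close> holds only increasing pairs, neither orientation of
        \<open>uv\<close> occurs, so walks in \<open>S\<close> avoid this edge and
        \<open>no_shortcut\<close> applies.\<close>
      have "S \<union> S\<inverse> \<subseteq> E - {(u, v), (v, u)}"
        using S AE E(2) False Slt Alt[OF uv] by (fastforce dest: symD)
      then have "(u, v) \<notin> ((S \<union> S\<inverse>)\<^sup>=) ^^ a"
        using relpow_reflcl_rel_mono[where k = a, of "S \<union> S\<inverse>" "E - {(u, v), (v, u)}"] E(4) uv AE
        by (auto simp: no_shortcut_def)
      moreover have "sym (S \<union> S\<inverse>)" by (rule sym_Un_converse)
      ultimately obtain k :: "nat \<Rightarrow> int" where
        k: "k u = 0" "k v = int a + 1" "\<And>p q. (p, q) \<in> S \<union> S\<inverse> \<Longrightarrow> \<bar>k p - k q\<bar> \<le> 1"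
        using exists_truncated_distance by metis
      have "ereal (\<alpha> * real r) < ereal (of_int (gadget_potential L k (v, 0, 0) - gadget_potential L k (u, 0, 0)))"
        using gap k(1,2) by (simp add: gadget_potential_def)
      also have "\<dots> \<le> graph_dist G (g u) (g v)"
        unfolding g_def
      proof (rule G(3))
        show "gadget_potential L k q \<le> gadget_potential L k p + 1" if "(p, q) \<in> R" for p q
          using that k(3) L unfolding R_def by (intro gadget_potential_lipschitz[of S]) auto
      qed (use slot \<open>u < m\<close> \<open>v < m\<close> in auto)
      finally show ?thesis using far[of "g u" "g v"] g \<open>u < m\<close> \<open>v < m\<close> False by simp
    qed
    then show "\<exists>P :: (nat \<Rightarrow> bool list) pmf. set_pmf P \<subseteq> {sk. \<forall>v\<in>{..<m}. sk v \<in> ?\<Lambda>} \<and>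
        (\<forall>(u, v)\<in>A. measure_pmf.prob P {sk. D r (sk u, sk v) \<longleftrightarrow> (u, v) \<in> S} \<ge> 2 / 3)"
      using P g by (intro exI[of _ "map_pmf (\<lambda>sk u. sk (g u)) P"]) fastforce
  qed (use finA Am in auto)
  also have "card ?\<Lambda> = 2 ^ s n"
    using card_lists_length_eq[of "UNIV :: bool set" "s n"] by simp
  finally have "(32/27 :: real) ^ card A \<le> 2 ^ (3 * (s n * m))"
    by (simp add: power_mult[symmetric] mult.commute[of 3])
  then have "ln ((32/27 :: real) ^ card A) \<le> ln (2 ^ (3 * (s n * m)))"
    by (intro ln_mono) auto
  then have bits: "card A * ln (32/27) \<le> 3 * (s n * m) * ln 2" by (simp add: ln_realpow)
  have "real m * (d * ln (32/27)) = real (m * d) * ln (32/27)" by simp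
  also have "\<dots> \<le> real (4 * card A) * ln (32/27)"
    using of_nat_mono[OF md] by (rule mult_right_mono) simp
  also have "\<dots> = 4 * (card A * ln (32/27))" by simp
  also have "\<dots> \<le> 4 * (3 * (s n * m) * ln 2)" using bits by (intro mult_left_mono) auto
  also have "\<dots> = real m * (12 * ln 2 * s n)" by simp
  finally show ?thesis using m by simp
qed

theorem theorem5p6:
  fixes \<alpha> :: real and s :: "nat \<Rightarrow> nat"
  assumes "\<alpha> > 1"
    and "has_distance_invariant_adt_sketch \<alpha> s (max_degree_le 3)"
  shows "\<forall>\<epsilon>>0. (\<lambda>n. real (s n)) \<in> \<Omega>(\<lambda>n. real n powr (1 / (4 * \<alpha>) - \<epsilon>))"
proof (intro allI impI)
  fix \<epsilon> :: real assume "\<epsilon> > 0"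
  obtain D where D: "is_adt_sketch \<alpha> s (max_degree_le 3) D"
    using assms(2) by (auto simp: has_distance_invariant_adt_sketch_def)
  \<comment> \<open>The choice satisfies \<open>\<alpha> < a + 1\<close>, so a suitable
    \<open>C\<close> exists, and \<open>a \<le> \<alpha>\<close>, so
    \<open>2 * a + 1 \<le> 4 * \<alpha>\<close>.\<close>
  define a where "a = nat \<lfloor>\<alpha>\<rfloor>"
  have a: "1 \<le> a" "real a \<le> \<alpha>" "\<alpha> < real a + 1"
    using assms(1) by (auto simp: a_def le_nat_iff of_nat_nat)
  obtain C :: nat where C: "2 * \<alpha> / (real a + 1 - \<alpha>) < real C" using reals_Archimedean2 by blast
  then have C': "2 * \<alpha> < (real a + 1 - \<alpha>) * C" using a(3) by (simp add: pos_divide_less_eq mult.commute)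
  have "0 < 2 * \<alpha> / (real a + 1 - \<alpha>)" using assms(1) a(3) by simp
  with C have C1: "1 \<le> C" by linarith
  define p where "p = 2 * a + 1"
  define K where "K = C * 2 ^ (2 * a + 3)"
  have K1: "1 \<le> K" using C1 by (simp add: K_def)
  define \<beta> where "\<beta> = 1 / real p"
  have \<beta>: "1 / (4 * \<alpha>) \<le> \<beta>" "0 < \<beta>" "\<beta> \<le> 1"
    using a assms(1) by (auto simp: \<beta>_def p_def intro!: divide_left_mono mult_pos_pos)
  \<comment> \<open>The factor \<open>K powr \<beta>\<close> undoes the scaling of \<open>n\<close>
    by \<open>K\<close>, and the 2 pays for rounding down to \<open>d\<close>.\<close>
  define c where "c = ln (32/27) / (12 * ln 2 * (2 * K powr \<beta>)) "
  have "c > 0" using K1 by (simp add: c_def)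
  have bound: "c * real n powr (1 / (4 * \<alpha>) - \<epsilon>) \<le> real (s n)" if n: "K \<le> n" for n
  proof -
    \<comment> \<open>The largest degree with \<open>K * d ^ p \<le> n\<close>.\<close>
    define d where "d = nat \<lfloor>(real n / K) powr \<beta>\<rfloor>"
    have ge1: "1 \<le> (real n / K) powr \<beta>"
      using n K1 \<beta>(2) by (intro ge_one_powr_ge_zero) auto
    then have d: "1 \<le> d" "real d \<le> (real n / K) powr \<beta>" "(real n / K) powr \<beta> < real d + 1"
      by (auto simp: d_def le_nat_iff of_nat_nat)
    have "real d ^ p \<le> ((real n / K) powr \<beta>) ^ p" using d(2) by (intro power_mono) auto
    also have "\<dots> = real n / K"
    proof -
      have "\<beta> * real p = 1" by (simp add: \<beta>_def p_def)
      then show ?thesis using n K1 by (simp add: powr_power mult.commute)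
    qed
    finally have "real (K * d ^ p) \<le> real n" using K1 by (simp add: pos_le_divide_eq mult.commute)
    then have "C * 2 ^ (2 * a + 3) * d ^ (2 * a + 1) \<le> n" by (simp only: of_nat_le_iff K_def p_def)
    from sketch_size_lower_bound[OF D a(1) C1 d(1) C' this]
    have *: "real d * ln (32/27) \<le> 12 * ln 2 * real (s n)" .
    have "real n powr (1 / (4 * \<alpha>) - \<epsilon>) \<le> real n powr \<beta>"
      using n K1 \<beta>(1) \<open>\<epsilon> > 0\<close> by (intro powr_mono) auto
    also have "\<dots> = K powr \<beta> * (real n / K) powr \<beta>"
      using K1 by (simp add: powr_divide)
    also have "\<dots> \<le> K powr \<beta> * (2 * d)" using d by (intro mult_left_mono) auto
    finally have "c * real n powr (1 / (4 * \<alpha>) - \<epsilon>) \<le> c * (K powr \<beta> * (2 * d))"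
      using \<open>c > 0\<close> by (intro mult_left_mono) auto
    also have "\<dots> = real d * ln (32/27) / (12 * ln 2)" using K1 by (simp add: c_def field_simps)
    also have "\<dots> \<le> real (s n)" using * by (simp add: pos_divide_le_eq mult.commute)
    finally show ?thesis .
  qed
  show "(\<lambda>n. real (s n)) \<in> \<Omega>(\<lambda>n. real n powr (1 / (4 * \<alpha>) - \<epsilon>))"
  proof (rule landau_omega.bigI[OF \<open>c > 0\<close>])
    show "\<forall>\<^sub>F n in sequentially. norm (real (s n)) \<ge> c * norm (real n powr (1 / (4 * \<alpha>) - \<epsilon>))"
      using eventually_ge_at_top[of K] by eventually_elim (use bound in simp)
  qed
qed

end
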